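(* Let $E:\mathbb{R}^d\to\mathbb{R}$ be twice continuously differentiable, and let $x_\star$ be a nondegenerate critical point of $E$ with Hessian $H_\star=\nabla^2E(x_\star)$ and Morse index $j$. Fix a target index $k\in\{1,\dots,d-1\}$, and let $s(x)$ and $\alpha(x)$ be continuous real-valued functions in a neighborhood of $x_\star$ with $$s_\star:=s(x_\star)\in(\lambda_k(H_\star),\lambda_{k+1}(H_\star)),\qquad\alpha_\star:=\alpha(x_\star)>0.$$ Let $\phi:J\to\mathbb{R}$ be an odd sign-preserving filter on an interval $J\subset\mathbb{R}$ (its scalar design interval). Assume that every scaled shifted eigenvalue $\alpha_\star(\lambda_i(H_\star)-s_\star)$, $i=1,\dots,d$, lies in $J$, and that, for $x$ sufficiently near $x_\star$, the spectrum of $\alpha(x)(\nabla^2E(x)-s(x)I)$ remains in $J$. Consider, near $x_\star$, the discrete map $$F_\eta(x)=x-\eta\,\phi\bigl(\alpha(x)(\nabla^2E(x)-s(x)I)\bigr)\nabla E(x).$$ Then the Jacobian of $F_\eta$ at $x_\star$ is diagonalizable in an orthonormal eigenbasis of $H_\star$ and has eigenvalues $$\mu_i(\eta)=1-\eta\,\phi\bigl(\alpha_\star(\lambda_i(H_\star)-s_\star)\bigr)\lambda_i(H_\star),\qquad i=1,\dots,d.$$ If $j=k$, then every factor $\phi\bigl(\alpha_\star(\lambda_i(H_\star)-s_\star)\bigr)\lambda_i(H_\star)$ is positive and $x_\star$ is a locally linearly attracting fixed point of $F_\eta$ whenever $$0<\eta<\frac{2}{\max_i\phi\bigl(\alpha_\star(\lambda_i(H_\star)-s_\star)\bigr)\lambda_i(H_\star)}.$$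 If $j\ne k$, then for every $\eta>0$ at least $|j-k|$ eigenvalues of $DF_\eta(x_\star)$ satisfy $|\mu_i(\eta)|>1$, so the fixed point is locally unstable.
   Context: For symmetric $A\in\mathbb{R}^{d\times d}$, $\lambda_1(A)\le\cdots\le\lambda_d(A)$ are its ordered eigenvalues. For a scalar function $f$ defined on the spectrum of a symmetric matrix $A=Q\operatorname{diag}(\mu_i)Q^T$ ($Q$ orthogonal), $f(A)=Q\operatorname{diag}(f(\mu_i))Q^T$. An (odd) sign-preserving filter on an interval $J$ is a continuous odd function $\phi:J\to\mathbb{R}$ with $\phi(t)\,t>0$ for every $t\in J\setminus\{0\}$ (so $J$ is symmetric about $0$). A critical point $x_\star$ ($\nabla E(x_\star)=0$) is nondegenerate if $\nabla^2E(x_\star)$ is invertible; its Morse index is the number of negative eigenvalues of $\nabla^2E(x_\star)$ counted with multiplicity. Locally linearly attracting means that iterates started sufficiently near $x_\star$ converge to $x_\star$ at a linear (geometric) rate. *)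

theory Defs
  imports "HOL-Analysis.Analysis" "HOL-Computational_Algebra.Computational_Algebra"
begin

text \<open>The dimension \<open>d\<close> is \<open>CARD('n)\<close> throughout.\<close>

definition gradient :: "(real^'n \<Rightarrow> real) \<Rightarrow> real^'n \<Rightarrow> real^'n" where
  "gradient E x = (THE D. GDERIV E x :> D)"

definition hessian :: "(real^'n \<Rightarrow> real) \<Rightarrow> real^'n \<Rightarrow> real^'n^'n" where
  "hessian E x = jacobian (gradient E) (at x)"

definition twice_continuously_differentiable :: "(real^'n \<Rightarrow> real) \<Rightarrow> bool" where
  "twice_continuously_differentiable E \<longleftrightarrow>
     (\<forall>x. E differentiable (at x)) \<and>
     (\<forall>x. gradient E differentiable (at x)) \<and>
     continuous_on UNIV (hessian E)"

definition nondegenerate_critical_point :: "(real^'n \<Rightarrow> real) \<Rightarrow> real^'n \<Rightarrow> bool" where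
  "nondegenerate_critical_point E x \<longleftrightarrow> gradient E x = 0 \<and> invertible (hessian E x)"

definition charpoly :: "real^'n^'n \<Rightarrow> real poly" where
  "charpoly A = det (mat [:0, 1:] - map_matrix (\<lambda>a. [:a:]) A)"

text \<open>
  The real eigenvalues with algebraic multiplicity. For symmetric \<open>A\<close> these are all the
  eigenvalues, so the multiset has \<open>CARD('n)\<close> elements.
\<close>

definition eigvals :: "real^'n^'n \<Rightarrow> real multiset" where
  "eigvals A = proots (charpoly A)"

text \<open>
  The \<open>i\<close>-th smallest eigenvalue. Indices start at 1; for symmetric \<open>A\<close> the meaningful
  range is \<open>1 \<le> i \<le> CARD('n)\<close>.
\<close>

definition eigval :: "real^'n^'n \<Rightarrow> nat \<Rightarrow> real" where
  "eigval A i = sorted_list_of_multiset (eigvals A) ! (i - 1)"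

definition morse_index :: "(real^'n \<Rightarrow> real) \<Rightarrow> real^'n \<Rightarrow> nat" where
  "morse_index E x = size {# t \<in># eigvals (hessian E x). t < 0 #}"

definition diag_mat :: "real^'n \<Rightarrow> real^'n^'n" where
  "diag_mat v = (\<chi> i j. if i = j then v $ i else 0)"

text \<open>
  \<open>f(A)\<close> for symmetric \<open>A\<close>: the matrix below does not depend on the orthogonal
  diagonalization chosen. Only the values of \<open>f\<close> on the spectrum of \<open>A\<close> matter.
\<close>

definition matrix_fun :: "(real \<Rightarrow> real) \<Rightarrow> real^'n^'n \<Rightarrow> real^'n^'n" where
  "matrix_fun f A =
     (THE B. \<exists>Q v. orthogonal_matrix Q \<and> A = Q ** diag_mat v ** transpose Q \<and>
                   B = Q ** diag_mat (\<chi> i. f (v $ i)) ** transpose Q)"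

definition sign_preserving_filter :: "real set \<Rightarrow> (real \<Rightarrow> real) \<Rightarrow> bool" where
  "sign_preserving_filter J \<phi> \<longleftrightarrow>
     is_interval J \<and> continuous_on J \<phi> \<and>
     (\<forall>t\<in>J. - t \<in> J \<and> \<phi> (- t) = - \<phi> t) \<and>
     (\<forall>t\<in>J - {0}. \<phi> t * t > 0)"

definition scaled_shifted_hessian ::
  "(real^'n \<Rightarrow> real) \<Rightarrow> (real^'n \<Rightarrow> real) \<Rightarrow> (real^'n \<Rightarrow> real) \<Rightarrow> real^'n \<Rightarrow> real^'n^'n" where
  "scaled_shifted_hessian E s \<alpha> x = \<alpha> x *\<^sub>R (hessian E x - s x *\<^sub>R mat 1)"

definition filtered_map ::
  "(real^'n \<Rightarrow> real) \<Rightarrow> (real^'n \<Rightarrow> real) \<Rightarrow> (real^'n \<Rightarrow> real) \<Rightarrow> (real \<Rightarrow> real) \<Rightarrow> real \<Rightarrow>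
   real^'n \<Rightarrow> real^'n" where
  "filtered_map E s \<alpha> \<phi> \<eta> x =
     x - \<eta> *\<^sub>R (matrix_fun \<phi> (scaled_shifted_hessian E s \<alpha> x) *v gradient E x)"

definition mode_factor :: "real^'n^'n \<Rightarrow> real \<Rightarrow> real \<Rightarrow> (real \<Rightarrow> real) \<Rightarrow> nat \<Rightarrow> real" where
  "mode_factor H s \<alpha> \<phi> i = \<phi> (\<alpha> * (eigval H i - s)) * eigval H i"

text \<open>
  Both notions depend only on the map near the point: under the contraction the orbits stay in
  the ball, and for instability \<open>\<epsilon>\<close> may be shrunk and only the first exit
  from the \<open>\<epsilon>\<close>-ball matters.
\<close>

definition locally_linearly_attracting :: "('a::metric_space \<Rightarrow> 'a) \<Rightarrow> 'a \<Rightarrow> bool" where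
  "locally_linearly_attracting F p \<longleftrightarrow>
     F p = p \<and>
     (\<exists>\<delta>>0. \<exists>q. 0 \<le> q \<and> q < 1 \<and>
        (\<forall>x\<in>ball p \<delta>. (\<lambda>n. (F ^^ n) x) \<longlonglongrightarrow> p \<and>
           (\<forall>n. dist ((F ^^ Suc n) x) p \<le> q * dist ((F ^^ n) x) p)))"

text \<open>Instability is the negation of Lyapunov stability.\<close>

definition locally_unstable :: "('a::metric_space \<Rightarrow> 'a) \<Rightarrow> 'a \<Rightarrow> bool" where
  "locally_unstable F p \<longleftrightarrow>
     F p = p \<and>
     \<not> (\<forall>\<epsilon>>0. \<exists>\<delta>>0. \<forall>x\<in>ball p \<delta>. \<forall>n. (F ^^ n) x \<in> ball p \<epsilon>)"

end

theory Submission
  imports Defs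
begin

text \<open>
  Write \<open>H\<close> for the Hessian at the critical point \<open>p\<close>, \<open>\<lambda>\<^sub>i\<close> for its ordered eigenvalues and
  \<open>P\<close> for the matrix \<open>\<phi>(\<alpha> (H - s I))\<close>, with \<open>\<alpha>\<close> and \<open>s\<close> taken at \<open>p\<close>.

  The gradient vanishes at \<open>p\<close>. A product of a matrix field that is merely continuous at \<open>p\<close> with
  a vector field that is differentiable and zero there is differentiable at \<open>p\<close>, and the derivative
  does not see how the matrix varies (\<open>has_derivative_matrix_mult_vanishing\<close>). So
  the Jacobian of the filtered map is \<open>I - \<eta> P H\<close>, as soon as the filtered matrix is continuous at
  \<open>p\<close> (\<open>isCont_matrix_fun\<close>). That continuity comes from compactness of the orthogonal group:
  diagonalizations of nearby matrices accumulate at a diagonalization of the limit, and \<open>\<phi>\<close> is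
  continuous on a set that contains all the spectra involved.
  Functional calculus makes sense because the Hessian is symmetric (\<open>transpose_hessian\<close>) and
  symmetric matrices are orthogonally diagonalizable (\<open>spectral_theorem\<close>).

  An orthonormal eigenbasis of \<open>H\<close> diagonalizes \<open>P\<close> and \<open>H\<close> simultaneously, which gives the
  eigenvalues \<open>1 - \<eta> c\<^sub>i\<close> with \<open>c\<^sub>i = \<phi>(\<alpha> (\<lambda>\<^sub>i - s)) \<lambda>\<^sub>i\<close>. The first factor is negative exactly for
  \<open>i \<le> k\<close>, since \<open>s\<close> separates \<open>\<lambda>\<^sub>k\<close> from \<open>\<lambda>\<^sub>k\<^sub>+\<^sub>1\<close> and \<open>\<phi>\<close> preserves signs; the second is negative
  exactly for \<open>i \<le> j\<close>, by the definition of the Morse index (\<open>eigval_negative_iff\<close>). So \<open>c\<^sub>i\<close> is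
  negative precisely when \<open>i\<close> lies strictly above the smaller and weakly below the larger of
  \<open>j\<close> and \<open>k\<close>, which happens for \<open>|j - k|\<close> indices.

  If \<open>j = k\<close>, the step size bound puts every \<open>1 - \<eta> c\<^sub>i\<close> in the interval \<open>(-1, 1)\<close>. The Jacobian is
  symmetric, so its Euclidean operator norm is then below 1, and the map contracts distances to
  \<open>p\<close> (\<open>attracting_if_derivative_contracts\<close>). If \<open>j \<noteq> k\<close>, each negative \<open>c\<^sub>i\<close> gives an eigenvalue
  above 1. The filtered map is known to be differentiable only at \<open>p\<close> itself, so unstable manifolds
  are not at hand; a quadratic form that grows geometrically along orbits near \<open>p\<close> replaces them
  (\<open>unstable_if_expanding_eigenvector\<close>).
\<close>

(* Both vectors and formal power series claim this symbol; below it always selects a vector entry. *)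
no_notation fps_nth (infixl \<open>$\<close> 75)

section \<open>Orthogonal diagonalization of symmetric matrices\<close>

lemma inner_symmetric_matrix_mult:
  fixes A :: "real^'n^'n"
  assumes "transpose A = A"
  shows "x \<bullet> (A *v y) = (A *v x) \<bullet> y"
  by (metis assms dot_lmul_matrix transpose_matrix_vector)

text \<open>A maximizer \<open>v\<close> of the Rayleigh quotient on the unit sphere of the subspace is an eigenvector.
  The residual \<open>w = A v - c v\<close> lies in the subspace by invariance, and moving from \<open>v\<close> in the
  direction \<open>w\<close> changes the quotient to first order by \<open>2 (w \<bullet> w)\<close>; maximality forces \<open>w = 0\<close>.\<close>

lemma eigenvector_in_invariant_subspace:
  fixes A :: "real^'n^'n"
  assumes sym: "transpose A = A" and S: "subspace S" and inv: "\<And>x. x \<in> S \<Longrightarrow> A *v x \<in> S"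
    and nz: "x0 \<in> S" "x0 \<noteq> 0"
  obtains v c where "v \<in> S" "norm v = 1" "A *v v = c *\<^sub>R v"
proof -
  let ?K = "S \<inter> sphere 0 1"
  have "compact ?K"
    using closed_subspace[OF S] by (simp add: closed_Int_compact)
  moreover have "(1 / norm x0) *\<^sub>R x0 \<in> ?K"
    using S nz by (auto simp: subspace_def)
  moreover have "continuous_on ?K (\<lambda>x. x \<bullet> (A *v x))"
    by (intro continuous_intros)
  ultimately obtain v where v: "v \<in> ?K" and max: "\<And>y. y \<in> ?K \<Longrightarrow> y \<bullet> (A *v y) \<le> v \<bullet> (A *v v)"
    using continuous_attains_sup[of ?K "\<lambda>x. x \<bullet> (A *v x)"] by blast
  define c where "c = v \<bullet> (A *v v)"
  define w where "w = A *v v - c *\<^sub>R v"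
  have vS: "v \<in> S" and v1: "norm v = 1" using v by auto
  have wS: "w \<in> S"
    unfolding w_def using S vS inv by (simp add: subspace_diff subspace_scale)
  have le: "y \<bullet> (A *v y) \<le> c * (y \<bullet> y)" if "y \<in> S" for y
  proof (cases "y = 0")
    case False
    then have "(1 / norm y) *\<^sub>R y \<in> ?K"
      using S that by (auto simp: subspace_def)
    from max[OF this] have "(y \<bullet> (A *v y)) / (norm y)\<^sup>2 \<le> c"
      by (simp add: c_def matrix_vector_mult_scaleR power2_eq_square)
    with False show ?thesis
      by (simp add: divide_le_eq power2_norm_eq_inner)
  qed simp
  define a where "a = c * (w \<bullet> w) - w \<bullet> (A *v w)"
  have key: "2 * t * (w \<bullet> w) \<le> t\<^sup>2 * a" for t
  proof -
    have "v + t *\<^sub>R w \<in> S" using S vS wS by (simp add: subspace_add subspace_scale)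
    from le[OF this] have "(v + t *\<^sub>R w) \<bullet> (A *v (v + t *\<^sub>R w)) \<le> c * ((v + t *\<^sub>R w) \<bullet> (v + t *\<^sub>R w))" .
    moreover have "v \<bullet> (A *v w) = (A *v v) \<bullet> w" by (rule inner_symmetric_matrix_mult[OF sym])
    moreover have "(A *v v) \<bullet> w = w \<bullet> w + c * (v \<bullet> w)"
      unfolding w_def by (simp add: inner_diff_left inner_diff_right inner_commute algebra_simps)
    moreover have "v \<bullet> v = 1" using v1 by (simp add: dot_square_norm)
    ultimately show ?thesis
      by (simp add: a_def c_def[symmetric] matrix_vector_right_distrib matrix_vector_mult_scaleR
          inner_add_left inner_add_right inner_commute power2_eq_square algebra_simps)
  qed
  have "w = 0"
  proof (rule ccontr)
    assume "w \<noteq> 0"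
    then have p: "w \<bullet> w > 0" by simp
    \<comment> \<open>small enough that the quadratic term \<open>t\<^sup>2 a\<close> cannot compensate the linear one\<close>
    define t where "t = (w \<bullet> w) / (\<bar>a\<bar> + 1)"
    have t: "t > 0" using p by (simp add: t_def)
    from key[of t] t have "2 * (w \<bullet> w) \<le> t * a" by (simp add: power2_eq_square)
    also have "\<dots> \<le> t * (\<bar>a\<bar> + 1)" using t by (intro mult_left_mono) auto
    also have "\<dots> = w \<bullet> w" by (simp add: t_def)
    finally show False using p by simp
  qed
  then show ?thesis using that vS v1 by (simp add: w_def)
qed

text \<open>The orthogonal complement of a set of eigenvectors is again invariant, because the matrix is
  symmetric, so the family can be extended as long as it does not span the space.\<close>

lemma orthonormal_eigenvectors:
  fixes A :: "real^'n^'n"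
  assumes sym: "transpose A = A" and "n \<le> CARD('n)"
  shows "\<exists>B. finite B \<and> card B = n \<and> pairwise orthogonal B \<and> (\<forall>b\<in>B. norm b = 1 \<and> (\<exists>c. A *v b = c *\<^sub>R b))"
  using assms(2)
proof (induction n)
  case 0
  then show ?case by (intro exI[of _ "{}"]) (auto simp: pairwise_def)
next
  case (Suc n)
  then obtain B where B: "finite B" "card B = n" "pairwise orthogonal B"
      "\<And>b. b \<in> B \<Longrightarrow> norm b = 1" "\<And>b. b \<in> B \<Longrightarrow> \<exists>c. A *v b = c *\<^sub>R b"
    by (metis Suc_leD)
  define S where "S = {x. \<forall>b\<in>B. b \<bullet> x = 0}"
  have "dim B < DIM(real^'n)"
    using dim_le_card'[OF B(1)] B(2) Suc.prems by simp
  then obtain x0 where "x0 \<noteq> 0" "\<And>y. y \<in> span B \<Longrightarrow> orthogonal x0 y"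
    using orthogonal_to_subspace_exists by blast
  then have x0: "x0 \<in> S" "x0 \<noteq> 0"
    by (auto simp: S_def orthogonal_def inner_commute span_base)
  have "subspace S"
    by (auto simp: S_def subspace_def inner_add_right)
  moreover have "A *v x \<in> S" if "x \<in> S" for x
    using that B(5) by (fastforce simp: S_def inner_symmetric_matrix_mult[OF sym])
  ultimately obtain v c where v: "v \<in> S" "norm v = 1" "A *v v = c *\<^sub>R v"
    using eigenvector_in_invariant_subspace[OF sym] x0 by metis
  have "v \<notin> B"
    using v(1,2) by (force simp: S_def)
  then have "card (insert v B) = Suc n" using B by simp
  moreover have "pairwise orthogonal (insert v B)"
    using B(3) v(1) by (auto simp: pairwise_insert S_def orthogonal_def inner_commute)
  ultimately show ?case
    using B v by (intro exI[of _ "insert v B"]) auto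
qed

lemma matrix_mul_diag_mat: "(M ** diag_mat v) $ i $ j = M $ i $ j * v $ j"
  for M :: "real^'n^'n"
  by (simp add: matrix_matrix_mult_def diag_mat_def if_distrib cong: if_cong)

lemma diag_mat_mul_matrix: "(diag_mat v ** M) $ i $ j = v $ i * M $ i $ j"
  for M :: "real^'n^'n"
  by (simp add: matrix_matrix_mult_def diag_mat_def if_distrib[of "\<lambda>x. x * _"] cong: if_cong)

theorem spectral_theorem:
  fixes A :: "real^'n^'n"
  assumes sym: "transpose A = A"
  obtains Q v where "orthogonal_matrix Q" "A = Q ** diag_mat v ** transpose Q"
proof -
  obtain B where B: "finite B" "card B = CARD('n)" "pairwise orthogonal B"
      "\<And>b. b \<in> B \<Longrightarrow> norm b = 1" "\<And>b. b \<in> B \<Longrightarrow> \<exists>c. A *v b = c *\<^sub>R b"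
    using orthonormal_eigenvectors[OF sym order_refl] by metis
  obtain f :: "'n \<Rightarrow> _" where f: "bij_betw f UNIV B"
    using B(1,2) finite_same_card_bij[of "UNIV :: 'n set" B] by auto
  then have fB: "f i \<in> B" for i by (auto simp: bij_betw_def)
  obtain g where g: "\<And>b. b \<in> B \<Longrightarrow> A *v b = g b *\<^sub>R b" using B(5) by metis
  define Q :: "real^'n^'n" where "Q = (\<chi> i j. f j $ i)"
  define v :: "real^'n" where "v = (\<chi> i. g (f i))"
  have col: "column i Q = f i" for i by (simp add: column_def Q_def vec_eq_iff)
  have Q: "orthogonal_matrix Q"
    unfolding orthogonal_matrix_orthonormal_columns col
    using B(3,4) f fB by (auto simp: pairwise_def bij_betw_def inj_eq)
  have "A ** Q = Q ** diag_mat v"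
  proof -
    have "(A ** Q) $ i $ j = (A *v f j) $ i" for i j
      by (simp add: matrix_matrix_mult_def matrix_vector_mult_def Q_def)
    then show ?thesis
      by (simp add: vec_eq_iff matrix_mul_diag_mat g[OF fB]) (simp add: Q_def v_def)
  qed
  then have "A = Q ** diag_mat v ** transpose Q"
    using Q by (metis matrix_mul_assoc matrix_mul_rid orthogonal_matrix_def)
  with Q that show ?thesis by blast
qed

section \<open>Eigenvalues with multiplicity\<close>

definition const_mat :: "real^'n^'n \<Rightarrow> real poly^'n^'n" where
  "const_mat A = map_matrix (\<lambda>a. [:a:]) A"

lemma const_mat_mult: "const_mat (A ** B) = const_mat A ** const_mat B"
  for A B :: "real^'n^'n"
proof -
  have "[:sum f I:] = (\<Sum>i\<in>I. [:f i:])" for f :: "'n \<Rightarrow> real" and I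
    by (induction I rule: infinite_finite_induct) (simp_all add: add_pCons[symmetric] del: add_pCons, metis add_pCons add_0)
  then show ?thesis
    by (simp add: const_mat_def map_matrix_def matrix_matrix_mult_def vec_eq_iff mult.commute)
qed

lemma const_mat_1: "const_mat (mat 1) = mat 1"
  by (simp add: const_mat_def map_matrix_def mat_def vec_eq_iff)

lemma mat_mul_commute: "mat c ** M = M ** mat c" for M :: "'a::comm_ring_1^'n^'n"
  by (simp add: vec_eq_iff matrix_matrix_mult_def mat_def if_distrib if_distribR cong: if_cong)

text \<open>Orthogonal conjugation does not change the characteristic polynomial, and that of a diagonal
  matrix splits into the linear factors given by its entries. Repeated entries are repeated
  roots, so multiplicities are right automatically.\<close>

lemma eigvals_diagonalized:
  fixes Q :: "real^'n^'n"
  assumes Q: "orthogonal_matrix Q"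
  shows "eigvals (Q ** diag_mat v ** transpose Q) = image_mset (\<lambda>i. v $ i) (mset_set UNIV)"
proof -
  let ?P = "const_mat Q" and ?R = "const_mat (transpose Q)" and ?D = "const_mat (diag_mat v)"
  let ?X = "mat [:0, 1:] :: real poly^'n^'n"
  have PR: "?P ** ?R = mat 1"
    using Q by (simp add: orthogonal_matrix_def const_mat_1 flip: const_mat_mult)
  have "?X - const_mat (Q ** diag_mat v ** transpose Q) = ?P ** (?X - ?D) ** ?R"
  proof -
    have "?P ** (?X - ?D) ** ?R = ?P ** ?X ** ?R - ?P ** ?D ** ?R"
      by (simp add: vec_eq_iff matrix_matrix_mult_def algebra_simps sum_subtractf)
    also have "?P ** ?X ** ?R = ?X"
      by (metis PR mat_mul_commute matrix_mul_assoc matrix_mul_rid)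
    finally show ?thesis by (simp add: const_mat_mult)
  qed
  then have "charpoly (Q ** diag_mat v ** transpose Q) = det ?P * det ?R * det (?X - ?D)"
    by (simp add: charpoly_def det_mul flip: const_mat_def)
  also have "det ?P * det ?R = 1"
    using PR by (metis det_I det_mul)
  also have "det (?X - ?D) = (\<Prod>i\<in>UNIV. (?X - ?D) $ i $ i)"
    by (rule det_diagonal) (simp add: const_mat_def map_matrix_def mat_def diag_mat_def)
  also have "\<dots> = (\<Prod>i\<in>UNIV. [:- v $ i, 1:])"
    by (simp add: const_mat_def map_matrix_def mat_def diag_mat_def)
  finally show ?thesis
    unfolding eigvals_def by (simp add: proots_prod sum_unfold_sum_mset)
qed

lemma image_mset_mset_set_bij:
  assumes "bij_betw e A B"
  shows "image_mset g (mset_set B) = image_mset (\<lambda>i. g (e i)) (mset_set A)"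
proof -
  have "mset_set B = image_mset e (mset_set A)"
    using assms by (simp add: bij_betw_def image_mset_mset_set)
  then show ?thesis by (simp add: multiset.map_comp o_def)
qed

text \<open>The eigenvalues of a diagonalization come indexed by \<open>'n\<close> in an arbitrary order. Sorting the
  index type by eigenvalue matches them with the ordered eigenvalues, and thereby turns the
  columns of \<open>Q\<close> into an eigenbasis adapted to that order.\<close>

lemma eigval_enumeration:
  fixes Q :: "real^'n^'n"
  assumes Q: "orthogonal_matrix Q" and A: "A = Q ** diag_mat v ** transpose Q"
  obtains e where "bij_betw e {1..CARD('n)} UNIV"
    "\<And>i. i \<in> {1..CARD('n)} \<Longrightarrow> eigval A i = v $ e i"
proof -
  obtain xs :: "'n list" where xs: "set xs = UNIV" "distinct xs"
    using finite_distinct_list[of "UNIV :: 'n set"] by auto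
  define ys where "ys = sort_key (($) v) xs"
  have ys: "set ys = UNIV" "distinct ys" by (simp_all add: ys_def xs)
  then have len: "length ys = CARD('n)" using distinct_card by fastforce
  have "mset (map (($) v) ys) = eigvals A"
    unfolding A eigvals_diagonalized[OF Q] using ys by (simp flip: mset_set_set)
  then have "sorted_list_of_multiset (eigvals A) = map (($) v) ys"
    by (metis sorted_list_of_multiset_mset sorted_sort_id sorted_sort_key ys_def)
  then have "eigval A i = v $ (ys ! (i - 1))" if "i \<in> {1..CARD('n)}" for i
    using that len by (auto simp: eigval_def)
  moreover have "bij_betw (\<lambda>i. ys ! (i - 1)) {1..CARD('n)} UNIV"
  proof -
    have "bij_betw (\<lambda>i. i - 1) {1..CARD('n)} {..<CARD('n)}"
      by (rule bij_betw_byWitness[where f' = Suc]) auto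
    then show ?thesis
      using bij_betw_trans[OF _ bij_betw_nth[OF ys(2) refl ys(1)[symmetric]]] unfolding len o_def by blast
  qed
  ultimately show ?thesis using that by blast
qed

lemma eigval_mono:
  fixes A :: "real^'n^'n"
  assumes "transpose A = A" "1 \<le> i" "i \<le> l" "l \<le> CARD('n)"
  shows "eigval A i \<le> eigval A l"
proof -
  obtain Q v where "orthogonal_matrix Q" "A = Q ** diag_mat v ** transpose Q"
    using spectral_theorem[OF assms(1)] .
  then have "size (eigvals A) = CARD('n)" by (simp add: eigvals_diagonalized)
  then have "length (sorted_list_of_multiset (eigvals A)) = CARD('n)"
    by (metis mset_sorted_list_of_multiset size_mset)
  then show ?thesis
    unfolding eigval_def using assms by (intro sorted_nth_mono) auto
qed

lemma eigvals_eq_image_eigval: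
  fixes A :: "real^'n^'n"
  assumes "transpose A = A"
  shows "eigvals A = image_mset (eigval A) (mset_set {1..CARD('n)})"
proof -
  obtain Q v where Q: "orthogonal_matrix Q" and A: "A = Q ** diag_mat v ** transpose Q"
    using spectral_theorem[OF assms(1)] .
  obtain e :: "nat \<Rightarrow> 'n" where e: "bij_betw e {1..CARD('n)} UNIV"
    and ev: "\<And>i. i \<in> {1..CARD('n)} \<Longrightarrow> eigval A i = v $ e i"
    using eigval_enumeration[OF Q A] by metis
  have "image_mset (eigval A) (mset_set {1..CARD('n)}) = image_mset (\<lambda>i. v $ e i) (mset_set {1..CARD('n)})"
    using ev by (intro image_mset_cong) auto
  then show ?thesis
    unfolding A eigvals_diagonalized[OF Q] image_mset_mset_set_bij[OF e] by (simp only:)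
qed

lemma down_closed_eq_atLeastAtMost_card:
  fixes S :: "nat set"
  assumes "finite S" and pos: "\<And>i. i \<in> S \<Longrightarrow> 1 \<le> i"
    and down: "\<And>i l. l \<in> S \<Longrightarrow> 1 \<le> i \<Longrightarrow> i \<le> l \<Longrightarrow> i \<in> S"
  shows "S = {1..card S}"
proof (cases "S = {}")
  case False
  then have "S = {1..Max S}"
    using assms Max_in[of S] Max_ge[of S] by (metis atLeastAtMost_iff subset_antisym subsetI)
  then show ?thesis by (metis card_atLeastAtMost diff_Suc_1)
qed simp

text \<open>The eigenvalues are sorted, so the indices of the negative ones form an initial segment; its
  length is the number of negative eigenvalues.\<close>

lemma eigval_negative_iff:
  fixes A :: "real^'n^'n"
  assumes sym: "transpose A = A" and i: "i \<in> {1..CARD('n)}"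
  shows "eigval A i < 0 \<longleftrightarrow> i \<le> size {# t \<in># eigvals A. t < 0 #}"
proof -
  let ?S = "{i \<in> {1..CARD('n)}. eigval A i < 0}"
  have "{# t \<in># eigvals A. t < 0 #} = image_mset (eigval A) (mset_set ?S)"
    by (simp add: eigvals_eq_image_eigval[OF sym] filter_mset_image_mset filter_mset_mset_set)
  then have "size {# t \<in># eigvals A. t < 0 #} = card ?S" by simp
  moreover have "?S = {1..card ?S}"
    by (rule down_closed_eq_atLeastAtMost_card) (use eigval_mono[OF sym] in force)+
  ultimately have "?S = {1..size {# t \<in># eigvals A. t < 0 #}}" by simp
  then have "i \<in> ?S \<longleftrightarrow> i \<in> {1..size {# t \<in># eigvals A. t < 0 #}}" by simp
  then show ?thesis using i by simp
qed

section \<open>Functions of symmetric matrices and their continuity\<close>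

text \<open>Two diagonalizations \<open>Q diag(v) Q\<^sup>T = P diag(w) P\<^sup>T\<close> are related by \<open>R = P\<^sup>T Q\<close> with
  \<open>R diag(v) = diag(w) R\<close>. Entrywise, \<open>R\<close> vanishes wherever \<open>v\<^sub>j \<noteq> w\<^sub>i\<close>, so the same relation holds
  with \<open>f\<close> applied to both spectra. Hence the value does not depend on the diagonalization, and
  the definite description in the definition denotes it.\<close>

lemma matrix_fun_diagonalized:
  fixes Q :: "real^'n^'n"
  assumes Q: "orthogonal_matrix Q"
  shows "matrix_fun f (Q ** diag_mat v ** transpose Q) = Q ** diag_mat (\<chi> i. f (v $ i)) ** transpose Q"
  unfolding matrix_fun_def
proof (rule the_equality)
  show "\<exists>P w. orthogonal_matrix P \<and> Q ** diag_mat v ** transpose Q = P ** diag_mat w ** transpose P \<and>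
      Q ** diag_mat (\<chi> i. f (v $ i)) ** transpose Q = P ** diag_mat (\<chi> i. f (w $ i)) ** transpose P"
    using Q by blast
next
  fix B
  assume "\<exists>P w. orthogonal_matrix P \<and> Q ** diag_mat v ** transpose Q = P ** diag_mat w ** transpose P \<and>
      B = P ** diag_mat (\<chi> i. f (w $ i)) ** transpose P"
  then obtain P w where P: "orthogonal_matrix P"
    and eq: "Q ** diag_mat v ** transpose Q = P ** diag_mat w ** transpose P"
    and B: "B = P ** diag_mat (\<chi> i. f (w $ i)) ** transpose P"
    by blast
  have QQ: "transpose Q ** Q = mat 1" "Q ** transpose Q = mat 1"
    and PP: "transpose P ** P = mat 1" "P ** transpose P = mat 1"
    using P Q by (auto simp: orthogonal_matrix_def)
  define R where "R = transpose P ** Q"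
  have "R ** diag_mat v = transpose P ** (Q ** diag_mat v ** transpose Q) ** Q"
    by (metis QQ(1) R_def matrix_mul_assoc matrix_mul_rid)
  also have "\<dots> = diag_mat w ** R"
    unfolding eq by (metis PP(1) R_def matrix_mul_assoc matrix_mul_lid)
  finally have "R $ i $ j * v $ j = w $ i * R $ i $ j" for i j
    by (metis matrix_mul_diag_mat diag_mat_mul_matrix)
  then have "R $ i $ j * f (v $ j) = f (w $ i) * R $ i $ j" for i j
    by (metis mult.commute mult_cancel_left)
  then have R: "R ** diag_mat (\<chi> i. f (v $ i)) = diag_mat (\<chi> i. f (w $ i)) ** R"
    by (simp add: vec_eq_iff matrix_mul_diag_mat diag_mat_mul_matrix)
  have "B = P ** (diag_mat (\<chi> i. f (w $ i)) ** R) ** transpose Q"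
    unfolding B R_def by (metis QQ(2) matrix_mul_assoc matrix_mul_rid)
  also have "\<dots> = Q ** diag_mat (\<chi> i. f (v $ i)) ** transpose Q"
    unfolding R[symmetric] by (metis R_def PP(2) matrix_mul_assoc matrix_mul_lid)
  finally show "B = Q ** diag_mat (\<chi> i. f (v $ i)) ** transpose Q" .
qed

lemma matrix_diag_transpose_entry:
  "(P ** diag_mat v ** transpose Q) $ i $ j = (\<Sum>k\<in>UNIV. P $ i $ k * v $ k * Q $ j $ k)"
  for P Q :: "real^'n^'n"
  by (subst matrix_matrix_mult_def) (simp add: matrix_mul_diag_mat transpose_def)

lemma bounded_orthogonal_matrices: "bounded {Q :: real^'n^'n. orthogonal_matrix Q}"
proof (intro boundedI)
  fix Q :: "real^'n^'n" assume "Q \<in> {Q. orthogonal_matrix Q}"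
  then have *: "norm (Q $ i) = 1" for i
    by (simp add: orthogonal_matrix_orthonormal_rows row_def)
  have "norm Q \<le> (\<Sum>i\<in>UNIV. norm (Q $ i))"
    unfolding norm_vec_def[of Q] by (rule L2_set_le_sum) simp
  then show "norm Q \<le> real CARD('n)" by (simp add: *)
qed

text \<open>Neither the eigenvectors nor their order need converge along the sequence. By compactness the
  orthogonal factors converge along a subsequence, to \<open>P\<close> say; then the diagonal
  factors \<open>Q\<^sub>n\<^sup>T X\<^sub>n Q\<^sub>n\<close> converge as well, and the limits diagonalize \<open>A\<close>. The limiting diagonal
  entries are eigenvalues of \<open>A\<close>, so they lie in \<open>J\<close>, where \<open>f\<close> is continuous.\<close>

lemma matrix_fun_subseq_tendsto:
  fixes X :: "nat \<Rightarrow> real^'n^'n"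
  assumes X: "X \<longlonglongrightarrow> A" and sym: "\<And>n. transpose (X n) = X n"
    and J: "\<And>n. set_mset (eigvals (X n)) \<subseteq> J" "set_mset (eigvals A) \<subseteq> J"
    and f: "continuous_on J f"
  shows "\<exists>r. strict_mono (r :: nat \<Rightarrow> nat) \<and> (\<lambda>n. matrix_fun f (X (r n))) \<longlonglongrightarrow> matrix_fun f A"
proof -
  have "\<exists>Q v. orthogonal_matrix Q \<and> X n = Q ** diag_mat v ** transpose Q" for n
    using spectral_theorem[OF sym] by metis
  then obtain Q v where Q: "\<And>n. orthogonal_matrix (Q n)"
    and XQ: "\<And>n. X n = Q n ** diag_mat (v n) ** transpose (Q n)"
    by metis
  have "bounded (range Q)"
    by (rule bounded_subset[OF bounded_orthogonal_matrices]) (use Q in auto)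
  then obtain P and r :: "nat \<Rightarrow> nat" where r: "strict_mono r" and "(Q \<circ> r) \<longlonglongrightarrow> P"
    using bounded_imp_convergent_subsequence by blast
  then have P: "(\<lambda>n. Q (r n) $ i $ j) \<longlonglongrightarrow> P $ i $ j" for i j
    unfolding o_def by (intro tendsto_intros)
  have X': "(\<lambda>n. X (r n) $ i $ j) \<longlonglongrightarrow> A $ i $ j" for i j
    using LIMSEQ_subseq_LIMSEQ[OF X r] unfolding o_def by (intro tendsto_intros)
  have "(\<lambda>n. (transpose (Q (r n)) ** Q (r n)) $ i $ j) \<longlonglongrightarrow> (transpose P ** P) $ i $ j" for i j
    unfolding matrix_matrix_mult_def transpose_def by (simp, intro tendsto_intros P)
  moreover have "transpose (Q (r n)) ** Q (r n) = mat 1" for n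
    using Q by (simp add: orthogonal_matrix)
  ultimately have orthP: "orthogonal_matrix P"
    by (simp add: orthogonal_matrix vec_eq_iff LIMSEQ_const_iff)
  define D where "D = transpose P ** A ** P"
  have diag: "diag_mat (v n) = transpose (Q n) ** X n ** Q n" for n
    unfolding XQ using Q[of n] by (metis matrix_mul_assoc matrix_mul_lid matrix_mul_rid orthogonal_matrix_def)
  have D: "(\<lambda>n. diag_mat (v (r n)) $ i $ j) \<longlonglongrightarrow> D $ i $ j" for i j
    unfolding diag D_def matrix_matrix_mult_def transpose_def by (simp, intro tendsto_intros P X')
  define w :: "real^'n" where "w = (\<chi> i. D $ i $ i)"
  have vw: "(\<lambda>n. v (r n) $ i) \<longlonglongrightarrow> w $ i" for i
    using D[of i i] by (simp add: diag_mat_def w_def)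
  have "D $ i $ j = 0" if "i \<noteq> j" for i j
    using D[of i j] that by (simp add: diag_mat_def LIMSEQ_const_iff)
  then have "D = diag_mat w"
    by (auto simp: diag_mat_def w_def vec_eq_iff)
  then have A: "A = P ** diag_mat w ** transpose P"
    using orthP D_def by (metis matrix_mul_assoc matrix_mul_lid matrix_mul_rid orthogonal_matrix_def)
  have "v n $ i \<in> J" for n i
    using J(1)[of n] unfolding XQ eigvals_diagonalized[OF Q] by auto
  moreover have wJ: "w $ i \<in> J" for i
    using J(2) unfolding A eigvals_diagonalized[OF orthP] by auto
  ultimately have fv: "(\<lambda>n. f (v (r n) $ i)) \<longlonglongrightarrow> f (w $ i)" for i
    using continuous_on_tendsto_compose[OF f vw] by simp
  have "(\<lambda>n. matrix_fun f (X (r n))) \<longlonglongrightarrow> matrix_fun f A"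
    unfolding XQ A matrix_fun_diagonalized[OF Q] matrix_fun_diagonalized[OF orthP]
    by (intro vec_tendstoI) (simp add: matrix_diag_transpose_entry, intro tendsto_intros P fv)
  with r show ?thesis by blast
qed

text \<open>If continuity failed, some sequence would stay at a positive distance from the limit along a
  subsequence, and a further subsequence would converge to it.\<close>

lemma isCont_matrix_fun:
  fixes M :: "'a::metric_space \<Rightarrow> real^'n^'n"
  assumes M: "isCont M p"
    and ev: "\<forall>\<^sub>F x in nhds p. transpose (M x) = M x \<and> set_mset (eigvals (M x)) \<subseteq> J"
    and f: "continuous_on J f"
  shows "isCont (\<lambda>x. matrix_fun f (M x)) p"
proof -
  obtain S where S: "open S" "p \<in> S"
    and SM: "\<And>x. x \<in> S \<Longrightarrow> transpose (M x) = M x" "\<And>x. x \<in> S \<Longrightarrow> set_mset (eigvals (M x)) \<subseteq> J"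
    using ev unfolding eventually_nhds by blast
  have "((\<lambda>x. matrix_fun f (M x)) \<longlongrightarrow> matrix_fun f (M p)) (at p within S)"
    unfolding tendsto_at_iff_sequentially
  proof (intro allI impI)
    fix X assume XS: "\<forall>i. X i \<in> S - {p}" and Xp: "X \<longlonglongrightarrow> p"
    let ?Y = "\<lambda>n. matrix_fun f (M (X n))"
    have "?Y \<longlonglongrightarrow> matrix_fun f (M p)"
    proof (rule ccontr)
      assume "\<not> ?thesis"
      then obtain e where e: "e > 0" "\<exists>\<^sub>F n in sequentially. dist (?Y n) (matrix_fun f (M p)) \<ge> e"
        by (auto simp: tendsto_iff frequently_def not_le not_less)
      then have inf: "infinite {n. dist (?Y n) (matrix_fun f (M p)) \<ge> e}"
        by (simp add: frequently_cofinite flip: cofinite_eq_sequentially)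
      then obtain q :: "nat \<Rightarrow> nat" where q: "strict_mono q"
          "\<And>n. dist (?Y (q n)) (matrix_fun f (M p)) \<ge> e"
        using infinite_enumerate by blast
      have lim: "(\<lambda>n. M (X (q n))) \<longlonglongrightarrow> M p"
        using isCont_tendsto_compose[OF M LIMSEQ_subseq_LIMSEQ[OF Xp q(1)]] by (simp add: o_def)
      obtain r :: "nat \<Rightarrow> nat" where "(\<lambda>n. ?Y (q (r n))) \<longlonglongrightarrow> matrix_fun f (M p)"
        using matrix_fun_subseq_tendsto[OF lim _ _ _ f] XS SM S(2) by auto
      then obtain n where "dist (?Y (q (r n))) (matrix_fun f (M p)) < e"
        using e(1) unfolding tendsto_iff eventually_sequentially by blast
      with q(2)[of "r n"] show False by simp
    qed
    then show "((\<lambda>x. matrix_fun f (M x)) \<circ> X) \<longlonglongrightarrow> matrix_fun f (M p)" by (simp add: o_def)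
  qed
  then show ?thesis
    unfolding isCont_def at_within_open[OF S(2,1)] .
qed

section \<open>Arithmetic of simultaneously diagonalized matrices\<close>

text \<open>The spectrum is a function instead of a vector, so that operations on matrices sharing the
  eigenbasis \<open>Q\<close> become pointwise operations under a \<open>\<lambda>\<close>.\<close>

definition conj_diag :: "real^'n^'n \<Rightarrow> ('n \<Rightarrow> real) \<Rightarrow> real^'n^'n" where
  "conj_diag Q f = Q ** diag_mat (\<chi> i. f i) ** transpose Q"

lemma conj_diag_entry: "conj_diag Q f $ i $ j = (\<Sum>k\<in>UNIV. Q $ i $ k * f k * Q $ j $ k)"
  by (simp add: conj_diag_def matrix_diag_transpose_entry)

lemma conj_diag_scaleR: "c *\<^sub>R conj_diag Q f = conj_diag Q (\<lambda>i. c * f i)"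
  by (simp add: vec_eq_iff conj_diag_entry sum_distrib_left algebra_simps)

lemma conj_diag_diff: "conj_diag Q f - conj_diag Q g = conj_diag Q (\<lambda>i. f i - g i)"
  by (simp add: vec_eq_iff conj_diag_entry algebra_simps flip: sum_subtractf)

lemma transpose_conj_diag: "transpose (conj_diag Q f) = conj_diag Q f"
  by (simp add: vec_eq_iff transpose_def conj_diag_entry mult.commute mult.left_commute)

lemma diag_mat_mult: "diag_mat v ** diag_mat w = diag_mat (\<chi> i. v $ i * w $ i)"
  by (simp add: vec_eq_iff diag_mat_mul_matrix) (simp add: diag_mat_def)

lemma diag_mat_1: "diag_mat (\<chi> i. 1) = mat 1"
  by (simp add: diag_mat_def mat_def vec_eq_iff)

lemma conj_diag_1: "orthogonal_matrix Q \<Longrightarrow> conj_diag Q (\<lambda>_. 1) = mat 1"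
  by (simp add: conj_diag_def diag_mat_1 orthogonal_matrix_def)

lemma conj_diag_mult:
  assumes "orthogonal_matrix Q"
  shows "conj_diag Q f ** conj_diag Q g = conj_diag Q (\<lambda>i. f i * g i)"
proof -
  have "conj_diag Q f ** conj_diag Q g =
      Q ** diag_mat (\<chi> i. f i) ** (transpose Q ** Q) ** diag_mat (\<chi> i. g i) ** transpose Q"
    by (simp add: conj_diag_def matrix_mul_assoc)
  also have "\<dots> = Q ** (diag_mat (\<chi> i. f i) ** diag_mat (\<chi> i. g i)) ** transpose Q"
    using assms by (simp add: orthogonal_matrix_def matrix_mul_assoc)
  finally show ?thesis by (simp add: diag_mat_mult conj_diag_def)
qed

lemma diag_mat_mult_vec: "(diag_mat v *v x) $ i = v $ i * x $ i"
  by (simp add: matrix_vector_mult_def diag_mat_def if_distrib[of "\<lambda>x. x * _"] cong: if_cong)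

lemma conj_diag_mult_vec:
  "conj_diag Q f *v x = Q *v (diag_mat (\<chi> i. f i) *v (transpose Q *v x))"
  by (simp only: conj_diag_def matrix_vector_mul_assoc matrix_mul_assoc)

lemma conj_diag_column:
  assumes "orthogonal_matrix Q"
  shows "conj_diag Q f *v column k Q = f k *\<^sub>R column k Q"
proof -
  have Q: "transpose Q *v column k Q = axis k 1"
    using assms by (metis matrix_vector_mul_assoc matrix_vector_mul_lid matrix_vector_mult_basis orthogonal_matrix_def)
  have D: "diag_mat (\<chi> i. f i) *v axis k 1 = f k *\<^sub>R axis k 1"
    unfolding matrix_vector_mult_basis by (auto simp: vec_eq_iff column_def diag_mat_def axis_def)
  show ?thesis
    unfolding conj_diag_mult_vec Q D by (simp only: matrix_vector_mult_scaleR matrix_vector_mult_basis)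
qed

lemma column_inner:
  fixes Q :: "real^'n^'n"
  assumes "orthogonal_matrix Q"
  shows "column k Q \<bullet> column l Q = (if k = l then 1 else 0)"
  using orthogonal_matrix_orthonormal_columns[THEN iffD1, OF assms]
  by (simp add: orthogonal_def dot_square_norm)

text \<open>The orthogonal factors are isometries, so only the diagonal one can change the norm.\<close>

lemma norm_conj_diag_le:
  fixes Q :: "real^'n^'n"
  assumes Q: "orthogonal_matrix Q" and q: "\<And>i. \<bar>f i\<bar> \<le> q"
  shows "norm (conj_diag Q f *v x) \<le> q * norm x"
proof -
  have q0: "0 \<le> q" using q[of undefined] by linarith
  have iso: "norm (R *v y) = norm y" if "orthogonal_matrix R" for R :: "real^'n^'n" and y
    using that by (simp add: orthogonal_transformation_norm orthogonal_transformation_matrix)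
  let ?y = "transpose Q *v x"
  have "norm (conj_diag Q f *v x) = norm (diag_mat (\<chi> i. f i) *v ?y)"
    by (simp only: conj_diag_mult_vec iso[OF Q])
  also have "\<dots> = L2_set (\<lambda>i. norm (f i * ?y $ i)) UNIV"
    by (simp add: norm_vec_def diag_mat_mult_vec)
  also have "\<dots> \<le> L2_set (\<lambda>i. q * norm (?y $ i)) UNIV"
    using q by (intro L2_set_mono) (auto simp: abs_mult intro: mult_right_mono)
  also have "\<dots> = q * norm ?y"
    by (simp add: norm_vec_def L2_set_right_distrib q0)
  also have "norm ?y = norm x" using Q by (intro iso) simp
  finally show ?thesis .
qed

lemma eigval_nonzero:
  fixes A :: "real^'n^'n"
  assumes sym: "transpose A = A" and inv: "invertible A" and i: "i \<in> {1..CARD('n)}"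
  shows "eigval A i \<noteq> 0"
proof -
  obtain Q v where Q: "orthogonal_matrix Q" and A: "A = Q ** diag_mat v ** transpose Q"
    using spectral_theorem[OF sym] .
  obtain e :: "nat \<Rightarrow> 'n" where ev: "\<And>i. i \<in> {1..CARD('n)} \<Longrightarrow> eigval A i = v $ e i"
    using eigval_enumeration[OF Q A] by metis
  have "A *v column (e i) Q = eigval A i *\<^sub>R column (e i) Q"
    using conj_diag_column[OF Q, of "\<lambda>i. v $ i" "e i"] by (simp add: conj_diag_def ev[OF i] flip: A)
  moreover have "column (e i) Q \<noteq> 0" using column_inner[OF Q, of "e i" "e i"] by auto
  moreover have "x = 0" if "A *v x = 0" for x
    using inv that unfolding invertible_def
    by (metis matrix_vector_mul_assoc matrix_vector_mul_lid matrix_vector_mult_0_right)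
  ultimately show ?thesis by force
qed

section \<open>Gradient and symmetry of the Hessian\<close>

text \<open>The gradient is a definite description, so both existence and uniqueness of the Riesz
  representative of the derivative are needed.\<close>

lemma GDERIV_gradient:
  fixes E :: "real^'n \<Rightarrow> real"
  assumes "E differentiable (at x)"
  shows "GDERIV E x :> gradient E x"
proof -
  obtain E' where E': "(E has_derivative E') (at x)"
    using assms by (auto simp: differentiable_def)
  define D where "D = (\<Sum>b\<in>Basis. E' b *\<^sub>R b)"
  have "E' h = h \<bullet> D" for h
  proof -
    interpret E': bounded_linear E' using E' by (rule has_derivative_bounded_linear)
    have "E' h = E' (\<Sum>b\<in>Basis. (h \<bullet> b) *\<^sub>R b)" by (simp add: euclidean_representation)
    also have "\<dots> = h \<bullet> D"
      by (simp add: E'.sum E'.scaleR D_def inner_sum_right mult.commute)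
    finally show ?thesis .
  qed
  then have "E' = (\<lambda>h. h \<bullet> D)" by (rule ext)
  with E' have D: "GDERIV E x :> D" by (simp add: gderiv_def)
  have "D' = D" if "GDERIV E x :> D'" for D'
  proof -
    have "(\<lambda>h. h \<bullet> D') = (\<lambda>h. h \<bullet> D)"
      using that D by (auto simp: gderiv_def intro: has_derivative_unique)
    then have "(D' - D) \<bullet> D' = (D' - D) \<bullet> D" by metis
    then show "D' = D" by (metis eq_iff_diff_eq_0 inner_diff_right inner_eq_zero_iff)
  qed
  with D show ?thesis
    unfolding gradient_def by (rule theI)
qed

text \<open>One application of the mean value theorem to \<open>u \<mapsto> E(x + u h + t k) - E(x + u h)\<close> expresses the
  second difference as the inner product of \<open>t h\<close> with a difference of gradients at two points
  within \<open>O(t)\<close> of \<open>x\<close>.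
  Differentiability of the gradient at \<open>x\<close> evaluates that difference to \<open>t G(k) + o(t)\<close>.\<close>

lemma second_difference_tendsto:
  fixes E :: "'a::real_inner \<Rightarrow> real"
  assumes g: "\<And>y. GDERIV E y :> g y" and G: "(g has_derivative G) (at x)"
  shows "((\<lambda>t. (E (x + t *\<^sub>R h + t *\<^sub>R k) - E (x + t *\<^sub>R h) - E (x + t *\<^sub>R k) + E x) / t\<^sup>2)
           \<longlongrightarrow> h \<bullet> G k) (at_right 0)"
proof -
  interpret G: bounded_linear G using G by (rule has_derivative_bounded_linear)
  define N where "N = norm h + norm k + 1"
  have N: "N > 0" by (simp add: N_def add_nonneg_pos)
  let ?\<Delta> = "\<lambda>t. E (x + t *\<^sub>R h + t *\<^sub>R k) - E (x + t *\<^sub>R h) - E (x + t *\<^sub>R k) + E x"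
  have "\<forall>\<^sub>F t in at_right 0. dist (?\<Delta> t / t\<^sup>2) (h \<bullet> G k) < e" if e: "e > 0" for e
  proof -
    \<comment> \<open>both points are within \<open>t N\<close> of \<open>x\<close>, and the error is at most \<open>|h| 2 c N < 2 c N\<^sup>2\<close>\<close>
    define c where "c = e / (2 * N * N)"
    have c: "c > 0" using e N by (simp add: c_def)
    obtain d where d: "d > 0"
      and dG: "\<And>y. norm (y - x) < d \<Longrightarrow> norm (g y - g x - G (y - x)) \<le> c * norm (y - x)"
      using G c unfolding has_derivative_at_alt by blast
    have "dist (?\<Delta> t / t\<^sup>2) (h \<bullet> G k) < e" if t: "0 < t" "t < d / N" for t
    proof -
      have tN: "t * N < d" using t N by (simp add: pos_less_divide_eq)
      define \<psi> where "\<psi> u = E (x + u *\<^sub>R h + t *\<^sub>R k) - E (x + u *\<^sub>R h)" for u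
      have "(\<psi> has_real_derivative (h \<bullet> g (x + u *\<^sub>R h + t *\<^sub>R k) - h \<bullet> g (x + u *\<^sub>R h))) (at u)" for u
      proof -
        have gd: "(E has_derivative (\<lambda>h. h \<bullet> g y)) (at y)" for y using g by (simp add: gderiv_def)
        have "((\<lambda>u. E (x + u *\<^sub>R h + t *\<^sub>R k)) has_derivative (\<lambda>z. (z *\<^sub>R h) \<bullet> g (x + u *\<^sub>R h + t *\<^sub>R k))) (at u)"
          by (rule has_derivative_compose[OF _ gd]) (auto intro!: derivative_eq_intros)
        moreover have "((\<lambda>u. E (x + u *\<^sub>R h)) has_derivative (\<lambda>z. (z *\<^sub>R h) \<bullet> g (x + u *\<^sub>R h))) (at u)"
          by (rule has_derivative_compose[OF _ gd]) (auto intro!: derivative_eq_intros)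
        ultimately show ?thesis
          unfolding has_field_derivative_def \<psi>_def
          by (rule has_derivative_eq_rhs[OF has_derivative_diff]) (auto simp: algebra_simps)
      qed
      then obtain u where u: "0 < u" "u < t"
        and mvt: "\<psi> t - \<psi> 0 = (t - 0) * (h \<bullet> g (x + u *\<^sub>R h + t *\<^sub>R k) - h \<bullet> g (x + u *\<^sub>R h))"
        using MVT2[OF t(1), of \<psi> "\<lambda>u. h \<bullet> g (x + u *\<^sub>R h + t *\<^sub>R k) - h \<bullet> g (x + u *\<^sub>R h)"] by auto
      define a b where "a = u *\<^sub>R h + t *\<^sub>R k" and "b = u *\<^sub>R h"
      have "norm a \<le> u * norm h + t * norm k"
        unfolding a_def using u t by (intro order_trans[OF norm_triangle_ineq]) simp
      also have "\<dots> \<le> t * norm h + t * norm k" using u by (simp add: mult_right_mono)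
      also have "\<dots> \<le> t * N" using t by (simp add: N_def algebra_simps)
      finally have a: "norm a \<le> t * N" .
      have "norm b \<le> t * norm h" unfolding b_def using u by (simp add: mult_right_mono)
      also have "\<dots> \<le> t * N" using t by (simp add: N_def algebra_simps)
      finally have b: "norm b \<le> t * N" .
      define r where "r y = g (x + y) - g x - G y" for y
      have r: "norm (r y) \<le> c * (t * N)" if "norm y \<le> t * N" for y
        using dG[of "x + y"] that tN c unfolding r_def
        by (smt (verit, best) add_diff_cancel_left' mult_left_mono)
      have "?\<Delta> t = \<psi> t - \<psi> 0" by (simp add: \<psi>_def)
      also have "\<dots> = t * (h \<bullet> (g (x + a) - g (x + b)))"
        using mvt by (simp add: a_def b_def inner_diff_right add.assoc)
      also have "g (x + a) - g (x + b) = G (a - b) + (r a - r b)"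
        by (simp add: r_def G.diff)
      also have "G (a - b) = t *\<^sub>R G k" by (simp add: a_def b_def G.scaleR)
      finally have "?\<Delta> t = t\<^sup>2 * (h \<bullet> G k) + t * (h \<bullet> (r a - r b))"
        by (simp add: inner_add_right power2_eq_square algebra_simps)
      then have "?\<Delta> t / t\<^sup>2 - h \<bullet> G k = (h \<bullet> (r a - r b)) / t"
        using t by (simp add: field_simps power2_eq_square)
      moreover have "\<bar>h \<bullet> (r a - r b)\<bar> \<le> norm h * (2 * (c * (t * N)))"
      proof -
        have "norm (r a - r b) \<le> norm (r a) + norm (r b)" by (rule norm_triangle_ineq4)
        also have "\<dots> \<le> 2 * (c * (t * N))" using r[OF a] r[OF b] by simp
        finally show ?thesis
          by (intro order_trans[OF Cauchy_Schwarz_ineq2] mult_left_mono) auto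
      qed
      ultimately have "dist (?\<Delta> t / t\<^sup>2) (h \<bullet> G k) \<le> norm h * (2 * (c * (t * N))) / t"
        using t by (simp only: dist_real_def abs_divide abs_of_pos divide_right_mono less_imp_le)
      also have "\<dots> = norm h * (e / N)" using t N by (simp add: c_def)
      also have "\<dots> < N * (e / N)"
        using e N by (intro mult_strict_right_mono) (auto simp: N_def add_nonneg_pos)
      also have "\<dots> = e" using N by simp
      finally show ?thesis .
    qed
    then show ?thesis
      using d N unfolding eventually_at_right_field by (intro exI[of _ "d / N"]) auto
  qed
  then show ?thesis by (auto simp: tendsto_iff)
qed

text \<open>The second difference is symmetric in the two directions, hence so is its limit.\<close>

lemma symmetric_second_derivative:
  fixes E :: "'a::real_inner \<Rightarrow> real"
  assumes "\<And>y. GDERIV E y :> g y" and "(g has_derivative G) (at x)"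
  shows "h \<bullet> G k = k \<bullet> G h"
proof -
  have "((\<lambda>t. (E (x + t *\<^sub>R h + t *\<^sub>R k) - E (x + t *\<^sub>R h) - E (x + t *\<^sub>R k) + E x) / t\<^sup>2)
           \<longlongrightarrow> k \<bullet> G h) (at_right 0)"
    using second_difference_tendsto[OF assms, of k h] by (simp add: algebra_simps)
  then show ?thesis
    using second_difference_tendsto[OF assms, of h k] tendsto_unique trivial_limit_at_right_real by blast
qed

lemma has_derivative_gradient:
  assumes "twice_continuously_differentiable E"
  shows "(gradient E has_derivative (\<lambda>h. hessian E x *v h)) (at x)"
  using assms unfolding twice_continuously_differentiable_def hessian_def
  by (simp flip: jacobian_works)

lemma transpose_hessian:
  assumes "twice_continuously_differentiable E"
  shows "transpose (hessian E x) = hessian E x"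
proof -
  have "h \<bullet> (hessian E x *v k) = k \<bullet> (hessian E x *v h)" for h k
    using assms by (intro symmetric_second_derivative[OF GDERIV_gradient has_derivative_gradient])
      (auto simp: twice_continuously_differentiable_def)
  from this[of "axis _ 1" "axis _ 1"] show ?thesis
    by (simp add: vec_eq_iff transpose_def inner_axis' matrix_vector_mul_component inner_axis)
qed

section \<open>Derivative of a matrix field applied to a vanishing vector field\<close>

lemma norm_matrix_vector_mult_le: "norm (A *v x) \<le> norm A * norm x" for A :: "real^'n^'m"
proof -
  have "norm (A *v x) = L2_set (\<lambda>i. \<bar>A $ i \<bullet> x\<bar>) UNIV"
    by (simp add: norm_vec_def[of "A *v x"] matrix_vector_mul_component)
  also have "\<dots> \<le> L2_set (\<lambda>i. norm (A $ i) * norm x) UNIV"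
    by (intro L2_set_mono Cauchy_Schwarz_ineq2) auto
  also have "\<dots> = norm A * norm x"
    by (simp add: norm_vec_def[of A] L2_set_left_distrib)
  finally show ?thesis .
qed

text \<open>Continuity of \<open>M\<close> is enough: in \<open>M x g x = M p g x + (M x - M p) g x\<close> the last term is \<open>o(1) O(|x - p|)\<close>, since \<open>g\<close> vanishes at
  \<open>p\<close>.\<close>

lemma has_derivative_matrix_mult_vanishing:
  fixes M :: "'a::real_normed_vector \<Rightarrow> real^'n^'m"
  assumes M: "isCont M p" and g: "(g has_derivative G) (at p)" and g0: "g p = 0"
  shows "((\<lambda>x. M x *v g x) has_derivative (\<lambda>h. M p *v G h)) (at p)"
proof -
  interpret G: bounded_linear G using g by (rule has_derivative_bounded_linear)
  obtain K where K: "K > 0" "\<And>x. norm (G x) \<le> norm x * K" using G.pos_bounded by blast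
  obtain d where d: "d > 0"
    and est: "\<And>y. norm (y - p) < d \<Longrightarrow> norm (g y - g p - G (y - p)) \<le> 1 * norm (y - p)"
    using g unfolding has_derivative_at_alt by (metis zero_less_one)
  have g_le: "norm (g y) \<le> (K + 1) * norm (y - p)" if "norm (y - p) < d" for y
  proof -
    have "norm (g y) \<le> norm (g y - G (y - p)) + norm (G (y - p))"
      using norm_triangle_ineq[of "g y - G (y - p)" "G (y - p)"] by simp
    also have "\<dots> \<le> norm (y - p) + norm (y - p) * K"
      using est[OF that] K by (intro add_mono) (auto simp: g0)
    finally show ?thesis by (simp add: algebra_simps)
  qed
  have "((\<lambda>y. norm ((M y - M p) *v g y) / norm (y - p)) \<longlongrightarrow> 0) (at p)"
  proof (rule Lim_null_comparison)
    have "((\<lambda>y. norm (M y - M p) * (K + 1)) \<longlongrightarrow> norm (M p - M p) * (K + 1)) (at p)"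
      using M unfolding isCont_def by (intro tendsto_intros)
    then show "((\<lambda>y. norm (M y - M p) * (K + 1)) \<longlongrightarrow> 0) (at p)" by simp
    have "norm (norm ((M y - M p) *v g y) / norm (y - p)) \<le> norm (M y - M p) * (K + 1)"
      if "y \<noteq> p" "dist y p < d" for y
    proof -
      have "norm ((M y - M p) *v g y) \<le> norm (M y - M p) * ((K + 1) * norm (y - p))"
        using that g_le by (intro order_trans[OF norm_matrix_vector_mult_le] mult_left_mono) (auto simp: dist_norm)
      then show ?thesis using that by (simp add: divide_le_eq mult.assoc)
    qed
    then show "\<forall>\<^sub>F y in at p. norm (norm ((M y - M p) *v g y) / norm (y - p)) \<le> norm (M y - M p) * (K + 1)"
      using d unfolding eventually_at by blast
  qed
  then have "((\<lambda>y. (M y - M p) *v g y) has_derivative (\<lambda>h. 0)) (at p)"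
    by (simp add: has_derivative_iff_norm g0)
  moreover have "((\<lambda>y. M p *v g y) has_derivative (\<lambda>h. M p *v G h)) (at p)"
    by (rule bounded_linear.has_derivative[OF matrix_vector_mul_bounded_linear g])
  ultimately have "((\<lambda>y. M p *v g y + (M y - M p) *v g y) has_derivative (\<lambda>h. M p *v G h + 0)) (at p)"
    by (intro has_derivative_add)
  then show ?thesis by (simp add: matrix_vector_mult_diff_rdistrib)
qed

lemma jacobian_eqI:
  fixes A :: "real^'n^'m"
  assumes "(f has_derivative (\<lambda>h. A *v h)) (at x)"
  shows "jacobian f (at x) = A"
  unfolding jacobian_def frechet_derivative_at[OF assms, symmetric] by simp

section \<open>Stability of a fixed point from the derivative at that point\<close>

text \<open>The gap between \<open>q\<close> and 1 absorbs the error of the linearization: near \<open>p\<close> the map contracts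
  distances to \<open>p\<close> by the factor \<open>(1 + q) / 2\<close>, so orbits stay near \<open>p\<close> and the estimate iterates.\<close>

lemma attracting_if_derivative_contracts:
  fixes F :: "'a::real_normed_vector \<Rightarrow> 'a"
  assumes F: "(F has_derivative L) (at p)" and fix_p: "F p = p"
    and q: "0 \<le> q" "q < 1" and L: "\<And>h. norm (L h) \<le> q * norm h"
  shows "locally_linearly_attracting F p"
proof -
  define c where "c = (1 + q) / 2"
  have c: "0 \<le> c" "c < 1" using q by (auto simp: c_def)
  obtain d where d: "d > 0"
    and est: "\<And>y. norm (y - p) < d \<Longrightarrow> norm (F y - F p - L (y - p)) \<le> (1 - q) / 2 * norm (y - p)"
    using F q unfolding has_derivative_at_alt by (metis diff_gt_0_iff_gt half_gt_zero)
  have step: "dist (F y) p \<le> c * dist y p" if "dist y p < d" for y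
  proof -
    have "norm (F y - p) \<le> norm (F y - F p - L (y - p)) + norm (L (y - p))"
      using norm_triangle_ineq[of "F y - F p - L (y - p)" "L (y - p)"] by (simp add: fix_p)
    also have "\<dots> \<le> (1 - q) / 2 * norm (y - p) + q * norm (y - p)"
      using est[of y] L that by (intro add_mono) (auto simp: dist_norm)
    also have "\<dots> = c * norm (y - p)" by (simp add: c_def field_simps)
    finally show ?thesis by (simp add: dist_norm)
  qed
  have orbit: "dist ((F ^^ n) x) p \<le> c ^ n * dist x p \<and> dist ((F ^^ n) x) p < d" if "dist x p < d" for x n
  proof (induction n)
    case (Suc n)
    then have "dist ((F ^^ Suc n) x) p \<le> c * dist ((F ^^ n) x) p" by (simp add: step)
    moreover have "c * dist ((F ^^ n) x) p \<le> c * (c ^ n * dist x p)"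
      using Suc c by (intro mult_left_mono) auto
    moreover have "c * dist ((F ^^ n) x) p \<le> 1 * dist ((F ^^ n) x) p"
      using c by (intro mult_right_mono) auto
    ultimately show ?case using Suc by auto
  qed (use that in simp)
  have "(\<lambda>n. (F ^^ n) x) \<longlonglongrightarrow> p" if "dist x p < d" for x
  proof -
    have "(\<lambda>n. c ^ n * dist x p) \<longlonglongrightarrow> 0 * dist x p"
      using c by (intro tendsto_intros LIMSEQ_power_zero) auto
    then have "(\<lambda>n. c ^ n * dist x p) \<longlonglongrightarrow> 0" by simp
    then have "(\<lambda>n. dist ((F ^^ n) x) p) \<longlonglongrightarrow> 0"
      by (rule Lim_null_comparison[rotated]) (use orbit[OF that] in auto)
    then show ?thesis by (simp flip: tendsto_dist_iff)
  qed
  moreover have "dist ((F ^^ Suc n) x) p \<le> c * dist ((F ^^ n) x) p" if "dist x p < d" for x n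
    using step orbit[OF that, of n] by simp
  ultimately have "\<forall>x\<in>ball p d. (\<lambda>n. (F ^^ n) x) \<longlonglongrightarrow> p \<and>
      (\<forall>n. dist ((F ^^ Suc n) x) p \<le> c * dist ((F ^^ n) x) p)"
    by (metis dist_commute mem_ball)
  then show ?thesis
    unfolding locally_linearly_attracting_def using fix_p d c by blast
qed

text \<open>Eigenvectors to different eigenvalues of a symmetric map are orthogonal, hence independent.\<close>

lemma finite_eigenvalues_of_symmetric:
  fixes L :: "'a::euclidean_space \<Rightarrow> 'a"
  assumes sym: "\<And>x y. x \<bullet> L y = L x \<bullet> y"
  shows "finite {c. \<exists>v. v \<noteq> 0 \<and> L v = c *\<^sub>R v}" (is "finite ?C")
proof -
  define f where "f c = (SOME v. v \<noteq> 0 \<and> L v = c *\<^sub>R v)" for c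
  have f: "f c \<noteq> 0 \<and> L (f c) = c *\<^sub>R f c" if "c \<in> ?C" for c
    unfolding f_def by (rule someI_ex) (use that in simp)
  have orth: "f a \<bullet> f b = 0" if "a \<in> ?C" "b \<in> ?C" "a \<noteq> b" for a b
    using sym[of "f a" "f b"] f[OF that(1)] f[OF that(2)] that(3) by simp
  then have "pairwise orthogonal (f ` ?C)"
    by (auto simp: pairwise_def orthogonal_def)
  moreover have "0 \<notin> f ` ?C"
  proof
    assume "0 \<in> f ` ?C"
    then obtain c where "c \<in> ?C" "f c = 0" by force
    then show False using f by blast
  qed
  ultimately have "independent (f ` ?C)" by (rule pairwise_orthogonal_independent)
  then have "finite (f ` ?C)" by (rule independent_imp_finite)
  moreover have "inj_on f ?C"
  proof (rule inj_onI, rule ccontr)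
    fix a b assume a: "a \<in> ?C" and b: "b \<in> ?C" and ab: "f a = f b" "a \<noteq> b"
    have "f a \<bullet> f a = 0" using orth[OF a b ab(2)] unfolding ab(1) .
    then show False using f[OF a] by simp
  qed
  ultimately show ?thesis by (rule finite_imageD)
qed

text \<open>Fix \<open>r\<close> with \<open>1 < r < |\<mu>|\<close> such that \<open>r\<close> and \<open>-r\<close> are not eigenvalues, and let
  \<open>T = L\<^sup>2 - r\<^sup>2\<close>, which is then injective. The quadratic form \<open>V h = h \<bullet> T h\<close> satisfies the identity
  \<open>V (L h) = r\<^sup>2 V h + |T h|\<^sup>2\<close> because \<open>L\<close> is symmetric. Injectivity bounds \<open>|T h|\<^sup>2\<close> below by a multiple
  of \<open>|h|\<^sup>2\<close>, which dominates the linearization error, so \<open>V\<close> grows at least by the factor \<open>r\<^sup>2 > 1\<close>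
  in each step taken near \<open>p\<close>. It is positive along the eigenvector \<open>v\<close>. An orbit that starts there
  and stays near \<open>p\<close> would have unbounded \<open>V\<close>, whereas \<open>V\<close> is bounded near \<open>p\<close>.\<close>

lemma unstable_if_expanding_eigenvector:
  fixes F :: "'a::euclidean_space \<Rightarrow> 'a"
  assumes F: "(F has_derivative L) (at p)" and fix_p: "F p = p"
    and sym: "\<And>x y. x \<bullet> L y = L x \<bullet> y"
    and v: "v \<noteq> 0" "L v = \<mu> *\<^sub>R v" and \<mu>: "\<bar>\<mu>\<bar> > 1"
  shows "locally_unstable F p"
proof -
  interpret L: bounded_linear L using F by (rule has_derivative_bounded_linear)
  let ?C = "{c. \<exists>v. v \<noteq> 0 \<and> L v = c *\<^sub>R v}"
  have "infinite ({1<..<\<bar>\<mu>\<bar>} - (?C \<union> uminus ` ?C))"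
    using finite_eigenvalues_of_symmetric[OF sym] \<mu> by (intro Diff_infinite_finite) auto
  then obtain r where r: "1 < r" "r < \<bar>\<mu>\<bar>" "r \<notin> ?C" "r \<notin> uminus ` ?C"
    by (metis (no_types, lifting) DiffE UnCI finite.emptyI greaterThanLessThan_iff ex_in_conv)
  have r': "- r \<notin> ?C" using r(4) by (metis (no_types) image_eqI minus_minus)
  define T where "T x = L (L x) - r\<^sup>2 *\<^sub>R x" for x
  have T: "bounded_linear T"
    unfolding T_def by (intro bounded_linear_sub L.bounded_linear_axioms
      bounded_linear_compose[OF L.bounded_linear_axioms] bounded_linear_scaleR_right)
  then interpret T: bounded_linear T .
  have "inj T"
  proof (rule linear_injective_0[THEN iffD2, OF T.linear_axioms], intro allI impI)
    fix x assume "T x = 0"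
    define y where "y = L x + r *\<^sub>R x"
    have "L y = r *\<^sub>R y"
      using \<open>T x = 0\<close> by (simp add: T_def y_def L.add L.scaleR power2_eq_square algebra_simps)
    then have "y = 0" using r(3) by blast
    then have "L x = (- r) *\<^sub>R x" by (simp add: y_def eq_neg_iff_add_eq_0)
    then show "x = 0" using r' by blast
  qed
  then obtain B where B: "B > 0" "\<And>x. B * norm x \<le> norm (T x)"
    using linear_inj_bounded_below_pos[OF T.linear_axioms] by blast
  obtain K where K: "K > 0" "\<And>x. norm (L x) \<le> norm x * K" using L.pos_bounded by blast
  obtain K' where K': "K' > 0" "\<And>x. norm (T x) \<le> norm x * K'" using T.pos_bounded by blast
  define V where "V h = h \<bullet> T h" for h
  have symT: "x \<bullet> T y = T x \<bullet> y" for x y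
    by (simp add: T_def inner_diff_left inner_diff_right sym)
  have V_L: "V (L h) = r\<^sup>2 * V h + (norm (T h))\<^sup>2" for h
  proof -
    have "T (L h) = L (T h)" by (simp add: T_def L.diff L.scaleR)
    then have "V (L h) = L (L h) \<bullet> T h" by (simp add: V_def sym)
    also have "L (L h) = T h + r\<^sup>2 *\<^sub>R h" by (simp add: T_def)
    finally show ?thesis by (simp add: V_def inner_add_left power2_norm_eq_inner)
  qed
  \<comment> \<open>a perturbation of \<open>L h\<close> of size at most \<open>e |h|\<close>, where \<open>e \<le> 1\<close>, changes \<open>V\<close> by at most \<open>e C |h|\<^sup>2\<close>\<close>
  define C where "C = 2 * K * K' + K'"
  have C: "C > 0" using K K' by (simp add: C_def add_pos_pos)
  define e where "e = min 1 (B\<^sup>2 / C)"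
  have e: "e > 0" "e \<le> 1" "e * C \<le> B\<^sup>2"
    using B C by (auto simp: e_def min_def field_simps)
  obtain d where d: "d > 0"
    and est: "\<And>y. norm (y - p) < d \<Longrightarrow> norm (F y - F p - L (y - p)) \<le> e * norm (y - p)"
    using F e(1) unfolding has_derivative_at_alt by blast
  have grow: "r\<^sup>2 * V (y - p) \<le> V (F y - p)" if "norm (y - p) < d" for y
  proof -
    define h o' where "h = y - p" and "o' = F y - p - L h"
    have o': "norm o' \<le> e * norm h" using est[OF that] by (simp add: o'_def h_def fix_p)
    then have o'': "norm o' \<le> norm h"
      using e(2) mult_right_mono[of e 1 "norm h"] by simp
    have "F y - p = L h + o'" by (simp add: o'_def)
    then have eq: "V (F y - p) = V (L h) + 2 * (o' \<bullet> T (L h)) + o' \<bullet> T o'"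
      by (simp add: V_def T.add inner_add_left inner_add_right symT[of "L h" o'] inner_commute)
    have "\<bar>o' \<bullet> T (L h)\<bar> \<le> norm o' * norm (T (L h))" by (rule Cauchy_Schwarz_ineq2)
    also have "\<dots> \<le> (e * norm h) * (norm h * K * K')"
      using K' K e by (intro mult_mono o' order_trans[OF K'(2)]) auto
    finally have 1: "\<bar>o' \<bullet> T (L h)\<bar> \<le> e * (K * K') * (norm h)\<^sup>2"
      by (simp add: power2_eq_square algebra_simps)
    have "\<bar>o' \<bullet> T o'\<bar> \<le> norm o' * norm (T o')" by (rule Cauchy_Schwarz_ineq2)
    also have "\<dots> \<le> (e * norm h) * (norm h * K')"
      using K' e by (intro mult_mono o' order_trans[OF K'(2)] o'') auto
    finally have 2: "\<bar>o' \<bullet> T o'\<bar> \<le> e * K' * (norm h)\<^sup>2"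
      by (simp add: power2_eq_square algebra_simps)
    have "e * C * (norm h)\<^sup>2 \<le> B\<^sup>2 * (norm h)\<^sup>2" using e by (intro mult_right_mono) auto
    also have "\<dots> \<le> (norm (T h))\<^sup>2"
      using B by (metis mult_nonneg_nonneg norm_ge_zero order_less_imp_le power_mono power_mult_distrib)
    finally have "2 * (e * (K * K') * (norm h)\<^sup>2) + e * K' * (norm h)\<^sup>2 \<le> (norm (T h))\<^sup>2"
      by (simp add: C_def algebra_simps)
    then show ?thesis
      unfolding eq V_L using 1 2 by (simp add: h_def)
  qed
  have "\<not> (\<forall>\<epsilon>>0. \<exists>\<delta>>0. \<forall>x\<in>ball p \<delta>. \<forall>n. (F ^^ n) x \<in> ball p \<epsilon>)"
  proof
    assume "\<forall>\<epsilon>>0. \<exists>\<delta>>0. \<forall>x\<in>ball p \<delta>. \<forall>n. (F ^^ n) x \<in> ball p \<epsilon>"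
    then obtain \<delta> where \<delta>: "\<delta> > 0" "\<And>x n. x \<in> ball p \<delta> \<Longrightarrow> (F ^^ n) x \<in> ball p d"
      using d by blast
    define t where "t = \<delta> / (2 * norm v)"
    have t: "t > 0" using \<delta> v by (simp add: t_def)
    define x where "x = p + t *\<^sub>R v"
    have "x \<in> ball p \<delta>" using \<delta>(1) v by (simp add: x_def t_def dist_norm)
    from \<delta>(2)[OF this] have stay: "norm ((F ^^ n) x - p) < d" for n
      by (simp add: dist_norm norm_minus_commute)
    have "V (x - p) = t\<^sup>2 * ((\<mu>\<^sup>2 - r\<^sup>2) * (v \<bullet> v))"
      by (simp add: V_def x_def T_def L.scaleR v(2) inner_diff_right power2_eq_square algebra_simps)
    moreover have "r\<^sup>2 < \<mu>\<^sup>2" using r(1,2) by (simp add: abs_square_less_1 flip: abs_le_square_iff not_le)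
    ultimately have V0: "V (x - p) > 0" using t v(1) by simp
    have lower: "(r\<^sup>2) ^ n * V (x - p) \<le> V ((F ^^ n) x - p)" for n
    proof (induction n)
      case (Suc n)
      have "(r\<^sup>2) ^ Suc n * V (x - p) \<le> r\<^sup>2 * V ((F ^^ n) x - p)"
        using mult_left_mono[OF Suc, of "r\<^sup>2"] by (simp add: mult.assoc)
      also have "\<dots> \<le> V ((F ^^ Suc n) x - p)" using grow[OF stay[of n]] by simp
      finally show ?case .
    qed simp
    have upper: "V ((F ^^ n) x - p) \<le> d * (d * K')" for n
    proof -
      have "V y \<le> norm y * (norm y * K')" for y
        unfolding V_def
        by (intro order_trans[OF norm_cauchy_schwarz] mult_left_mono K'(2)) auto
      also have "norm y * (norm y * K') \<le> d * (d * K')" if "norm y < d" for y :: 'a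
        using that K' d by (intro mult_mono) auto
      finally show ?thesis using stay[of n] .
    qed
    have "1 < r\<^sup>2" using r(1) by simp
    then obtain n where "d * (d * K') / V (x - p) < (r\<^sup>2) ^ n" using real_arch_pow by blast
    then have "d * (d * K') < (r\<^sup>2) ^ n * V (x - p)" using V0 by (simp add: divide_less_eq)
    with lower[of n] upper[of n] show False by linarith
  qed
  then show ?thesis using fix_p by (simp add: locally_unstable_def)
qed

section \<open>The filtered map at a critical point\<close>

lemma sign_preserving_filter_sign:
  assumes "sign_preserving_filter J \<phi>" "t \<in> J"
  shows "t < 0 \<Longrightarrow> \<phi> t < 0" "0 < t \<Longrightarrow> 0 < \<phi> t"
proof -
  have "0 < \<phi> t * t" if "t \<noteq> 0"
    using assms that by (auto simp: sign_preserving_filter_def)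
  then show "t < 0 \<Longrightarrow> \<phi> t < 0" "0 < t \<Longrightarrow> 0 < \<phi> t"
    by (auto simp: zero_less_mult_iff)
qed

theorem theorem4p5:
  fixes E s \<alpha> :: "real^'n \<Rightarrow> real"
    and xs :: "real^'n" and U :: "(real^'n) set"
    and \<phi> :: "real \<Rightarrow> real" and J :: "real set"
    and j k :: nat
  assumes E_C2: "twice_continuously_differentiable E"
    and crit: "nondegenerate_critical_point E xs"
    and index: "morse_index E xs = j"
    and k: "1 \<le> k" "k \<le> CARD('n) - 1"
    and nbhd: "open U" "xs \<in> U"
    and cont: "continuous_on U s" "continuous_on U \<alpha>"
    and shift: "eigval (hessian E xs) k < s xs" "s xs < eigval (hessian E xs) (k + 1)"
    and scale: "\<alpha> xs > 0"
    and filt: "sign_preserving_filter J \<phi>"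
    and in_J: "\<forall>i\<in>{1..CARD('n)}. \<alpha> xs * (eigval (hessian E xs) i - s xs) \<in> J"
    and near_J: "\<forall>\<^sub>F x in nhds xs. set_mset (eigvals (scaled_shifted_hessian E s \<alpha> x)) \<subseteq> J"
  shows
    "(\<forall>\<eta>. filtered_map E s \<alpha> \<phi> \<eta> differentiable (at xs) \<and>
       (\<exists>v :: nat \<Rightarrow> real^'n.
          (\<forall>i\<in>{1..CARD('n)}. \<forall>l\<in>{1..CARD('n)}. v i \<bullet> v l = (if i = l then 1 else 0)) \<and>
          (\<forall>i\<in>{1..CARD('n)}.
             hessian E xs *v v i = eigval (hessian E xs) i *\<^sub>R v i \<and>
             jacobian (filtered_map E s \<alpha> \<phi> \<eta>) (at xs) *v v i =
               (1 - \<eta> * mode_factor (hessian E xs) (s xs) (\<alpha> xs) \<phi> i) *\<^sub>R v i)) \<and>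
       eigvals (jacobian (filtered_map E s \<alpha> \<phi> \<eta>) (at xs)) =
         {# 1 - \<eta> * mode_factor (hessian E xs) (s xs) (\<alpha> xs) \<phi> i. i \<in># mset_set {1..CARD('n)} #}) \<and>
     (j = k \<longrightarrow>
       (\<forall>i\<in>{1..CARD('n)}. mode_factor (hessian E xs) (s xs) (\<alpha> xs) \<phi> i > 0) \<and>
       (\<forall>\<eta>. 0 < \<eta> \<and>
            \<eta> < 2 / Max (mode_factor (hessian E xs) (s xs) (\<alpha> xs) \<phi> ` {1..CARD('n)}) \<longrightarrow>
            locally_linearly_attracting (filtered_map E s \<alpha> \<phi> \<eta>) xs)) \<and>
     (j \<noteq> k \<longrightarrow>
       (\<forall>\<eta>>0.
          int (card {i\<in>{1..CARD('n)}.
                 \<bar>1 - \<eta> * mode_factor (hessian E xs) (s xs) (\<alpha> xs) \<phi> i\<bar> > 1}) \<ge> \<bar>int j - int k\<bar> \<and>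
          locally_unstable (filtered_map E s \<alpha> \<phi> \<eta>) xs))"
proof -
  define H where "H = hessian E xs"
  define c where "c i = mode_factor H (s xs) (\<alpha> xs) \<phi> i" for i
  have symH: "transpose H = H" unfolding H_def using E_C2 by (rule transpose_hessian)
  have grad0: "gradient E xs = 0" and invH: "invertible H"
    using crit by (auto simp: nondegenerate_critical_point_def H_def)
  obtain Q v where Q: "orthogonal_matrix Q" and Hv: "H = Q ** diag_mat v ** transpose Q"
    using spectral_theorem[OF symH] .
  obtain e :: "nat \<Rightarrow> 'n" where e: "bij_betw e {1..CARD('n)} UNIV"
    and ev: "\<And>i. i \<in> {1..CARD('n)} \<Longrightarrow> eigval H i = v $ e i"
    using eigval_enumeration[OF Q Hv] by metis
  have HQ: "H = conj_diag Q (\<lambda>k. v $ k)" by (simp add: Hv conj_diag_def)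
  define m where "m k = \<phi> (\<alpha> xs * (v $ k - s xs)) * v $ k" for k
  have cm: "c i = m (e i)" if "i \<in> {1..CARD('n)}" for i
    using that by (simp add: c_def mode_factor_def m_def ev)
  have ex_e: "\<exists>i\<in>{1..CARD('n)}. k = e i" for k
    using e by (auto simp: bij_betw_def)
  define Jac where "Jac \<eta> = conj_diag Q (\<lambda>k. 1 - \<eta> * m k)" for \<eta>

  have deriv: "(filtered_map E s \<alpha> \<phi> \<eta> has_derivative (\<lambda>h. Jac \<eta> *v h)) (at xs)" for \<eta>
  proof -
    let ?M = "scaled_shifted_hessian E s \<alpha>"
    have symM: "transpose (?M x) = ?M x" for x
      using transpose_hessian[OF E_C2, of x]
      by (simp add: scaled_shifted_hessian_def vec_eq_iff transpose_def mat_def)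
    have "isCont (hessian E) xs"
      using E_C2 by (simp add: twice_continuously_differentiable_def continuous_on_eq_continuous_at)
    then have contM: "isCont ?M xs"
      using cont nbhd unfolding scaled_shifted_hessian_def
      by (intro continuous_intros) (auto simp: continuous_on_eq_continuous_at)
    have contP: "isCont (\<lambda>x. matrix_fun \<phi> (?M x)) xs"
      using filt near_J symM by (intro isCont_matrix_fun[OF contM, of J]) (auto simp: sign_preserving_filter_def)
    have "?M xs = conj_diag Q (\<lambda>k. \<alpha> xs * (v $ k - s xs))"
      unfolding scaled_shifted_hessian_def
      by (simp add: HQ conj_diag_scaleR conj_diag_diff flip: H_def conj_diag_1[OF Q])
    then have P: "matrix_fun \<phi> (?M xs) = conj_diag Q (\<lambda>k. \<phi> (\<alpha> xs * (v $ k - s xs)))"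
      by (simp add: conj_diag_def matrix_fun_diagonalized[OF Q])
    have "((\<lambda>x. matrix_fun \<phi> (?M x) *v gradient E x) has_derivative
        (\<lambda>h. matrix_fun \<phi> (?M xs) *v (H *v h))) (at xs)"
      unfolding H_def by (rule has_derivative_matrix_mult_vanishing[OF contP has_derivative_gradient[OF E_C2] grad0])
    then have "(filtered_map E s \<alpha> \<phi> \<eta> has_derivative
        (\<lambda>h. h - \<eta> *\<^sub>R (matrix_fun \<phi> (?M xs) *v (H *v h)))) (at xs)"
      unfolding filtered_map_def[abs_def]
      by (intro has_derivative_diff has_derivative_ident has_derivative_scaleR_right)
    moreover have "Jac \<eta> = mat 1 - \<eta> *\<^sub>R (matrix_fun \<phi> (?M xs) ** H)"
      unfolding P HQ conj_diag_mult[OF Q] conj_diag_1[OF Q, symmetric]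
      by (simp add: Jac_def m_def conj_diag_scaleR conj_diag_diff)
    ultimately show ?thesis
      by (simp add: matrix_vector_mult_diff_rdistrib matrix_vector_mul_assoc scaleR_matrix_vector_assoc)
  qed
  have jac: "jacobian (filtered_map E s \<alpha> \<phi> \<eta>) (at xs) = Jac \<eta>" for \<eta>
    by (rule jacobian_eqI[OF deriv])
  have fix_xs: "filtered_map E s \<alpha> \<phi> \<eta> xs = xs" for \<eta>
    by (simp add: filtered_map_def grad0)
  have Jac_col: "Jac \<eta> *v column (e i) Q = (1 - \<eta> * c i) *\<^sub>R column (e i) Q"
    if "i \<in> {1..CARD('n)}" for \<eta> i
    by (simp add: Jac_def conj_diag_column[OF Q] cm[OF that])

  have part1: "\<exists>u :: nat \<Rightarrow> real^'n.
      (\<forall>i\<in>{1..CARD('n)}. \<forall>l\<in>{1..CARD('n)}. u i \<bullet> u l = (if i = l then 1 else 0)) \<and>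
      (\<forall>i\<in>{1..CARD('n)}. H *v u i = eigval H i *\<^sub>R u i \<and> Jac \<eta> *v u i = (1 - \<eta> * c i) *\<^sub>R u i)" for \<eta>
  proof (intro exI[of _ "\<lambda>i. column (e i) Q"] conjI ballI)
    fix i l assume i: "i \<in> {1..CARD('n)}" and l: "l \<in> {1..CARD('n)}"
    show "column (e i) Q \<bullet> column (e l) Q = (if i = l then 1 else 0)"
      using column_inner[OF Q] bij_betw_imp_inj_on[OF e] i l by (simp add: inj_on_eq_iff)
  next
    fix i assume i: "i \<in> {1..CARD('n)}"
    show "H *v column (e i) Q = eigval H i *\<^sub>R column (e i) Q"
      unfolding ev[OF i] unfolding HQ by (rule conj_diag_column[OF Q])
    show "Jac \<eta> *v column (e i) Q = (1 - \<eta> * c i) *\<^sub>R column (e i) Q"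
      by (rule Jac_col[OF i])
  qed
  have spectrum: "eigvals (Jac \<eta>) = {# 1 - \<eta> * c i. i \<in># mset_set {1..CARD('n)} #}" for \<eta>
  proof -
    have "eigvals (Jac \<eta>) = image_mset (\<lambda>k. 1 - \<eta> * m k) (mset_set UNIV)"
      by (simp add: Jac_def conj_diag_def eigvals_diagonalized[OF Q])
    also have "\<dots> = {# 1 - \<eta> * m (e i). i \<in># mset_set {1..CARD('n)} #}"
      by (rule image_mset_mset_set_bij[OF e])
    also have "\<dots> = {# 1 - \<eta> * c i. i \<in># mset_set {1..CARD('n)} #}"
      by (intro image_mset_cong) (simp add: cm)
    finally show ?thesis .
  qed

  have neg_iff: "eigval H i < 0 \<longleftrightarrow> i \<le> j" if "i \<in> {1..CARD('n)}" for i
    using eigval_negative_iff[OF symH that] index by (simp add: morse_index_def H_def)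
  \<comment> \<open>the two factors of \<open>c i\<close> are negative for \<open>i \<le> k\<close> and for \<open>i \<le> j\<close>, respectively\<close>
  have sgn_c: "(if (i \<le> j) = (i \<le> k) then 0 < c i else c i < 0)" if i: "i \<in> {1..CARD('n)}" for i
  proof -
    let ?t = "\<alpha> xs * (eigval H i - s xs)"
    have tJ: "?t \<in> J" using in_J i by (simp add: H_def)
    have c: "c i = \<phi> ?t * eigval H i" by (simp add: c_def mode_factor_def)
    have nz: "eigval H i \<noteq> 0" by (rule eigval_nonzero[OF symH invH i])
    have kd: "k + 1 \<le> CARD('n)" using k by linarith
    have "?t < 0" if "i \<le> k"
    proof -
      have "eigval H i \<le> eigval H k" using that i kd by (intro eigval_mono[OF symH]) auto
      then show ?thesis using shift(1) scale by (simp add: H_def mult_less_0_iff)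
    qed
    moreover have "?t > 0" if "\<not> i \<le> k"
    proof -
      have "eigval H (k + 1) \<le> eigval H i" using that i kd by (intro eigval_mono[OF symH]) auto
      then show ?thesis using shift(2) scale by (simp add: H_def)
    qed
    ultimately show ?thesis
      using sign_preserving_filter_sign[OF filt tJ] neg_iff[OF i] nz
      by (auto simp: c mult_less_0_iff zero_less_mult_iff not_le not_less)
  qed
  have j_le: "j \<le> CARD('n)"
  proof -
    have "j \<le> size (eigvals H)"
      using index by (auto simp: morse_index_def H_def intro!: size_mset_mono)
    then show ?thesis by (simp add: eigvals_eq_image_eigval[OF symH])
  qed

  have pos: "\<forall>i\<in>{1..CARD('n)}. 0 < c i" if "j = k"
    using sgn_c that by auto
  have attracting: "locally_linearly_attracting (filtered_map E s \<alpha> \<phi> \<eta>) xs"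
    if jk: "j = k" and \<eta>: "0 < \<eta>" "\<eta> < 2 / Max (c ` {1..CARD('n)})" for \<eta>
  proof -
    let ?q = "Max (range (\<lambda>k. \<bar>1 - \<eta> * m k\<bar>))"
    have "\<bar>1 - \<eta> * m k\<bar> < 1" for k
    proof -
      obtain i where i: "i \<in> {1..CARD('n)}" "k = e i" using ex_e by blast
      have ci: "0 < c i" "c i \<le> Max (c ` {1..CARD('n)})" using pos[OF jk] i by auto
      then have "\<eta> * Max (c ` {1..CARD('n)}) < 2" using \<eta> by (simp add: pos_less_divide_eq)
      moreover have "\<eta> * c i \<le> \<eta> * Max (c ` {1..CARD('n)})" using ci \<eta> by (intro mult_left_mono) auto
      moreover have "0 < \<eta> * c i" using ci \<eta> by simp
      ultimately have "\<bar>1 - \<eta> * c i\<bar> < 1" by linarith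
      then show ?thesis by (simp only: i(2) cm[OF i(1)])
    qed
    then have q1: "?q < 1" by (subst Max_less_iff) auto
    have q: "\<bar>1 - \<eta> * m k\<bar> \<le> ?q" for k by (rule Max_ge) auto
    then have "0 \<le> ?q" by (meson abs_ge_zero order_trans)
    then show ?thesis
      using q1 norm_conj_diag_le[OF Q q]
      by (intro attracting_if_derivative_contracts[OF deriv fix_xs]) (auto simp: Jac_def)
  qed

  \<comment> \<open>the indices on which \<open>i \<le> j\<close> and \<open>i \<le> k\<close> disagree\<close>
  let ?lo = "min j k" and ?hi = "max j k"
  have between: "i \<in> {1..CARD('n)}" "c i < 0" if "i \<in> {?lo<..?hi}" for i
  proof -
    show i: "i \<in> {1..CARD('n)}" using that k j_le by auto
    show "c i < 0" using sgn_c[OF i] that by (auto simp: min_def max_def split: if_splits)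
  qed
  have expanding: "\<bar>1 - \<eta> * c i\<bar> > 1" if "\<eta> > 0" "i \<in> {?lo<..?hi}" for \<eta> i
    using mult_pos_neg[OF that(1) between(2)[OF that(2)]] by simp
  have count: "\<bar>int j - int k\<bar> \<le> int (card {i\<in>{1..CARD('n)}. \<bar>1 - \<eta> * c i\<bar> > 1})" if "\<eta> > 0" for \<eta>
  proof -
    have "card {?lo<..?hi} \<le> card {i\<in>{1..CARD('n)}. \<bar>1 - \<eta> * c i\<bar> > 1}"
      using between(1) expanding[OF that] by (intro card_mono) auto
    then show ?thesis by (auto simp: min_def max_def split: if_splits)
  qed
  have unstable: "locally_unstable (filtered_map E s \<alpha> \<phi> \<eta>) xs" if jk: "j \<noteq> k" and \<eta>: "\<eta> > 0" for \<eta>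
  proof (rule unstable_if_expanding_eigenvector[OF deriv fix_xs])
    have hi: "?hi \<in> {?lo<..?hi}" using jk by auto
    show "x \<bullet> (Jac \<eta> *v y) = (Jac \<eta> *v x) \<bullet> y" for x y
      by (rule inner_symmetric_matrix_mult) (simp add: Jac_def transpose_conj_diag)
    show "Jac \<eta> *v column (e ?hi) Q = (1 - \<eta> * c ?hi) *\<^sub>R column (e ?hi) Q"
      by (rule Jac_col[OF between(1)[OF hi]])
    show "column (e ?hi) Q \<noteq> 0" using column_inner[OF Q, of "e ?hi" "e ?hi"] by auto
    show "\<bar>1 - \<eta> * c ?hi\<bar> > 1" by (rule expanding[OF \<eta> hi])
  qed

  have "filtered_map E s \<alpha> \<phi> \<eta> differentiable (at xs)" for \<eta>
    using deriv differentiable_def by blast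
  then show ?thesis
    unfolding jac H_def[symmetric] c_def[symmetric]
    using part1 spectrum pos attracting count unstable by blast
qed

end
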